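(* Consider the single decision maker setting described in the context, with rounds $t\in\{1,\dots,T\}$. Suppose: (H1) for all $t$, $\mathcal{E}_t=\boldsymbol{\mathcal{E}}$ for some fixed matrix $\boldsymbol{\mathcal{E}}\in\mathbb{R}^{m\times d}$; (H2) for all $t$, $\gamma_t=\gamma$ for some constant $\gamma\ge 0$, and the compliance variable $Z_t$ is conditionally independent of $\{X_t,B_t\}$ given $W_t$; (S1) there are a vector $\boldsymbol{\alpha}\in\mathbb{R}^m$ and a constant $\beta\in\mathbb{R}$ with $\mathrm{cBP}(\boldsymbol{\theta}_t)=\boldsymbol{\alpha}^\top\boldsymbol{\theta}_t+\beta$; (S2) for all $\boldsymbol{\theta}_t$, $\|\boldsymbol{\theta}_t\|_2\le 1$ (these are the admissible parameters). Then the optimal parameter vector for the decision maker, i.e. the maximiser of $\mathcal{Q}(\boldsymbol{\theta}_t)=\mathbb{E}[Y_t\mid W_t=1;\boldsymbol{\theta}_t]$ over admissible $\boldsymbol{\theta}_t$, can be expressed as $$\boldsymbol{\theta}^{\mathrm{AO}}=\frac{\boldsymbol{\alpha}+\gamma\boldsymbol{\mathcal{E}}\boldsymbol{\mathcal{E}}^\top\boldsymbol{\theta}^*}{\|\boldsymbol{\alpha}+\gamma\boldsymbol{\mathcal{E}}\boldsymbol{\mathcal{E}}^\top\boldsymbol{\theta}^*\|_2}.$$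
   Context: Single decision maker (DM) setting. In round $t$ the DM publishes a parameter vector $\boldsymbol{\theta}_t\in\mathbb{R}^m$ and a selection rule $\boldsymbol{\delta}_{\boldsymbol{\theta}_t}:\mathbb{R}^m\to[0,1]$. An agent arrives with random baseline $B_t\in\mathbb{R}^m$, effort conversion matrix $\mathcal{E}_t\in\mathbb{R}^{m\times d}$ and real-valued unobserved noise $O_t$ (correlated with $B_t$). If the agent takes action $\mathbf{a}\in\mathbb{R}^d$, its covariates are $X_t=B_t+\mathcal{E}_t\mathbf{a}$ and its predicted outcome is $\hat y_t=X_t^\top\boldsymbol{\theta}_t$. The agent chooses the action maximising $\gamma_t\hat y_t-\frac12\|\mathbf{a}\|_2^2$ (with $\gamma_t\ge0$), i.e. $\mathbf{a}_t=\gamma_t\mathcal{E}_t^\top\boldsymbol{\theta}_t$. The selection status is $W_t\in\{0,1\}$ with $W_t\sim\mathrm{Bernoulli}(\boldsymbol{\delta}_{\boldsymbol{\theta}_t}(X_t))$ given $X_t$. All agents comply with the decision they receive, so the compliance variable is $Z_t=W_t$. The outcome is $Y_t=X_t^\top\boldsymbol{\theta}^*+O_t$, where $\boldsymbol{\theta}^*\in\mathbb{R}^m$ is the fixed true causal parameter. The notation "$;\boldsymbol{\theta}_t$" indicates that the distribution is the one induced by deploying $\boldsymbol{\theta}_t$. The DM's objective decomposes as $$\mathcal{Q}(\boldsymbol{\theta}_t)=\mathbb{E}[Y_t\mid W_t=1;\boldsymbol{\theta}_t]=\mathrm{cBP}(\boldsymbol{\theta}_t)+\mathrm{cPI}(\boldsymbol{\theta}_t),$$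 $$\mathrm{cBP}(\boldsymbol{\theta}_t)=\mathbb{E}[B_t^\top\boldsymbol{\theta}^*+O_t\mid W_t=1;\boldsymbol{\theta}_t],\qquad \mathrm{cPI}(\boldsymbol{\theta}_t)=\mathbb{E}[(\mathcal{E}_t\mathbf{a}_t)^\top\boldsymbol{\theta}^*\mid W_t=1;\boldsymbol{\theta}_t].$$ *)

theory Defs
  imports "HOL-Probability.Probability"
begin

text \<open>
  One round. The sample point describes the arriving agent and the randomisation of the decision;
  the fields \<open>action\<close>, \<open>selected\<close> and \<open>complied\<close> take the deployed parameter vector
  as an argument and give the quantities that arise when it is deployed (this renders the
  notation ``; theta'' for the distribution induced by deploying theta).  The statuses W and Z
  in {0,1} are rendered as booleans.
\<close>

record ('w, 'm, 'd) agent_round =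
  baseline :: "'w \<Rightarrow> real ^ 'm"
  effort :: "'w \<Rightarrow> real ^ 'd ^ 'm"
  noise :: "'w \<Rightarrow> real"
  incentive :: real
  action :: "real ^ 'm \<Rightarrow> 'w \<Rightarrow> real ^ 'd"
  selected :: "real ^ 'm \<Rightarrow> 'w \<Rightarrow> bool"
  complied :: "real ^ 'm \<Rightarrow> 'w \<Rightarrow> bool"

definition covariates_of_action ::
  "('w, 'm::finite, 'd::finite) agent_round \<Rightarrow> 'w \<Rightarrow> real ^ 'd \<Rightarrow> real ^ 'm"
  where "covariates_of_action R \<omega> a = baseline R \<omega> + effort R \<omega> *v a"

definition agent_utility ::
  "('w, 'm::finite, 'd::finite) agent_round \<Rightarrow> real ^ 'm \<Rightarrow> 'w \<Rightarrow> real ^ 'd \<Rightarrow> real"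
  where "agent_utility R \<theta> \<omega> a =
    incentive R * (covariates_of_action R \<omega> a \<bullet> \<theta>) - 1 / 2 * (norm a)\<^sup>2"

definition covariates ::
  "('w, 'm::finite, 'd::finite) agent_round \<Rightarrow> real ^ 'm \<Rightarrow> 'w \<Rightarrow> real ^ 'm"
  where "covariates R \<theta> \<omega> = covariates_of_action R \<omega> (action R \<theta> \<omega>)"

definition outcome ::
  "real ^ 'm \<Rightarrow> ('w, 'm::finite, 'd::finite) agent_round \<Rightarrow> real ^ 'm \<Rightarrow> 'w \<Rightarrow> real"
  where "outcome \<theta>s R \<theta> \<omega> = covariates R \<theta> \<omega> \<bullet> \<theta>s + noise R \<omega>"

definition selected_event ::
  "'w measure \<Rightarrow> ('w, 'm::finite, 'd::finite) agent_round \<Rightarrow> real ^ 'm \<Rightarrow> 'w set"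
  where "selected_event M R \<theta> = {\<omega> \<in> space M. selected R \<theta> \<omega>}"

text \<open>
  \<open>uniform_measure M A\<close> is the conditional probability measure given the event \<open>A\<close>
  (a probability measure when \<open>A\<close> has positive probability), so integrals against it are
  the elementary conditional expectations given \<open>A\<close>.
\<close>

definition cond_expectation :: "'w measure \<Rightarrow> 'w set \<Rightarrow> ('w \<Rightarrow> real) \<Rightarrow> real"
  where "cond_expectation M A f = (\<integral>\<omega>. f \<omega> \<partial>uniform_measure M A)"

definition objective ::
  "'w measure \<Rightarrow> real ^ 'm \<Rightarrow> ('w, 'm::finite, 'd::finite) agent_round \<Rightarrow> real ^ 'm \<Rightarrow> real"
  where "objective M \<theta>s R \<theta> =
    cond_expectation M (selected_event M R \<theta>) (outcome \<theta>s R \<theta>)"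

definition cBP ::
  "'w measure \<Rightarrow> real ^ 'm \<Rightarrow> ('w, 'm::finite, 'd::finite) agent_round \<Rightarrow> real ^ 'm \<Rightarrow> real"
  where "cBP M \<theta>s R \<theta> =
    cond_expectation M (selected_event M R \<theta>) (\<lambda>\<omega>. baseline R \<omega> \<bullet> \<theta>s + noise R \<omega>)"

definition cPI ::
  "'w measure \<Rightarrow> real ^ 'm \<Rightarrow> ('w, 'm::finite, 'd::finite) agent_round \<Rightarrow> real ^ 'm \<Rightarrow> real"
  where "cPI M \<theta>s R \<theta> =
    cond_expectation M (selected_event M R \<theta>) (\<lambda>\<omega>. (effort R \<omega> *v action R \<theta> \<omega>) \<bullet> \<theta>s)"

text \<open>
  Conditional independence of \<open>Z\<close> (with values in \<open>S\<close>) and \<open>V\<close> (with values in \<open>N\<close>) given a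
  discrete random variable \<open>W\<close>: independence of the generated sigma-algebras under the
  conditional law given each value that \<open>W\<close> takes with positive probability.
\<close>

definition cond_indep_given ::
  "'w measure \<Rightarrow> ('w \<Rightarrow> 'c) \<Rightarrow> 'a measure \<Rightarrow> ('w \<Rightarrow> 'a) \<Rightarrow> 'b measure \<Rightarrow> ('w \<Rightarrow> 'b) \<Rightarrow> bool"
  where "cond_indep_given M W S Z N V \<longleftrightarrow>
    (\<forall>w. measure M {\<omega> \<in> space M. W \<omega> = w} > 0 \<longrightarrow>
      prob_space.indep_set (uniform_measure M {\<omega> \<in> space M. W \<omega> = w})
        (sets (vimage_algebra (space M) Z S))
        (sets (vimage_algebra (space M) V N)))"

text \<open>
  The single decision maker setting with admissible parameters \<open>\<Theta>\<close>.  No assumption is made on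
  the joint law of \<open>baseline\<close> and \<open>noise\<close>, so they may be correlated.  The last three
  assumptions say that the conditional expectations in the objective and in its summands \<open>cBP\<close> and \<open>cPI\<close>
  are well defined.
\<close>

locale selective_rounds = prob_space M
  for M :: "'w measure" +
  fixes T :: nat
    and R :: "nat \<Rightarrow> ('w, 'm::finite, 'd::finite) agent_round"
    and \<delta> :: "real ^ 'm \<Rightarrow> real ^ 'm \<Rightarrow> real"
    and \<theta>s :: "real ^ 'm"
    and \<Theta> :: "(real ^ 'm) set"
  assumes baseline_measurable: "\<And>t. t \<in> {1..T} \<Longrightarrow> baseline (R t) \<in> borel_measurable M"
    and effort_measurable: "\<And>t. t \<in> {1..T} \<Longrightarrow> effort (R t) \<in> borel_measurable M"
    and noise_measurable: "\<And>t. t \<in> {1..T} \<Longrightarrow> noise (R t) \<in> borel_measurable M"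
    and selected_measurable:
      "\<And>t \<theta>. t \<in> {1..T} \<Longrightarrow> \<theta> \<in> \<Theta> \<Longrightarrow> selected (R t) \<theta> \<in> measurable M (count_space UNIV)"
    and rule_measurable: "\<And>\<theta>. \<theta> \<in> \<Theta> \<Longrightarrow> \<delta> \<theta> \<in> borel_measurable borel"
    and rule_range: "\<And>\<theta> x. \<theta> \<in> \<Theta> \<Longrightarrow> \<delta> \<theta> x \<in> {0..1}"
    and incentive_nonneg: "\<And>t. t \<in> {1..T} \<Longrightarrow> incentive (R t) \<ge> 0"
    and action_best_response:
      "\<And>t \<theta> \<omega>. t \<in> {1..T} \<Longrightarrow> \<theta> \<in> \<Theta> \<Longrightarrow> \<omega> \<in> space M \<Longrightarrow>
        is_arg_max (agent_utility (R t) \<theta> \<omega>) (\<lambda>_. True) (action (R t) \<theta> \<omega>)"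
    and selected_bernoulli:
      "\<And>t \<theta>. t \<in> {1..T} \<Longrightarrow> \<theta> \<in> \<Theta> \<Longrightarrow>
        AE \<omega> in M.
          real_cond_exp M (vimage_algebra (space M) (covariates (R t) \<theta>) borel)
            (indicator (selected_event M (R t) \<theta>)) \<omega> = \<delta> \<theta> (covariates (R t) \<theta> \<omega>)"
    and full_compliance:
      "\<And>t \<theta> \<omega>. t \<in> {1..T} \<Longrightarrow> \<theta> \<in> \<Theta> \<Longrightarrow> \<omega> \<in> space M \<Longrightarrow>
        complied (R t) \<theta> \<omega> = selected (R t) \<theta> \<omega>"
    and selected_pos:
      "\<And>t \<theta>. t \<in> {1..T} \<Longrightarrow> \<theta> \<in> \<Theta> \<Longrightarrow> measure M (selected_event M (R t) \<theta>) > 0"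
    and baseline_outcome_integrable:
      "\<And>t \<theta>. t \<in> {1..T} \<Longrightarrow> \<theta> \<in> \<Theta> \<Longrightarrow>
        integrable (uniform_measure M (selected_event M (R t) \<theta>))
          (\<lambda>\<omega>. baseline (R t) \<omega> \<bullet> \<theta>s + noise (R t) \<omega>)"
    and improvement_integrable:
      "\<And>t \<theta>. t \<in> {1..T} \<Longrightarrow> \<theta> \<in> \<Theta> \<Longrightarrow>
        integrable (uniform_measure M (selected_event M (R t) \<theta>))
          (\<lambda>\<omega>. (effort (R t) \<omega> *v action (R t) \<theta> \<omega>) \<bullet> \<theta>s)"

end

theory Submission
  imports Defs
begin

text \<open>
  The utility falls short of its value at \<open>\<gamma> E\<^sup>T \<theta>\<close> by half the squared distance
  to this action, so it is the only best response, and \<open>cPI \<theta>\<close> is the conditional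
  expectation of the constant \<open>(\<gamma> E E\<^sup>T \<theta>s) \<bullet> \<theta>\<close>, whatever the selection rule.
  Hence the objective is \<open>c \<bullet> \<theta> + \<beta>\<close> with \<open>c = \<alpha> + \<gamma> E E\<^sup>T \<theta>s\<close>, which is maximal
  on the unit ball at \<open>c / norm c\<close>, only there if \<open>c \<noteq> 0\<close>.  For \<open>c = 0\<close> Isabelle's
  division gives the parameter 0, and the objective is constant.
\<close>

text \<open>Moving the effort matrix across the inner product turns the incentive term into
  \<open>a \<bullet> b \<theta> \<omega>\<close> plus a term free of \<open>a\<close>. Completing
  the square in \<open>a\<close> then gives an exact identity, which yields both optimality and
  uniqueness of \<open>b \<theta> \<omega>\<close>.\<close>

lemma agent_utility_completed_square:
  fixes R :: "('w, 'm::finite, 'd::finite) agent_round"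
  defines "b \<equiv> \<lambda>\<theta> \<omega>. incentive R *\<^sub>R (transpose (effort R \<omega>) *v \<theta>)"
  shows "agent_utility R \<theta> \<omega> a =
    agent_utility R \<theta> \<omega> (b \<theta> \<omega>) - 1 / 2 * (norm (a - b \<theta> \<omega>))\<^sup>2"
proof -
  have utility: "agent_utility R \<theta> \<omega> a' =
      incentive R * (baseline R \<omega> \<bullet> \<theta>) + a' \<bullet> b \<theta> \<omega> - 1 / 2 * (norm a')\<^sup>2" for a'
    by (simp add: agent_utility_def covariates_of_action_def b_def inner_add_left
        dot_lmul_matrix[symmetric] transpose_matrix_vector inner_commute algebra_simps)
  show ?thesis
    unfolding utility by (simp add: power2_norm_eq_inner inner_diff inner_commute algebra_simps)
qed

lemma best_response_unique:
  fixes R :: "('w, 'm::finite, 'd::finite) agent_round"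
  assumes "is_arg_max (agent_utility R \<theta> \<omega>) (\<lambda>_. True) a"
  shows "a = incentive R *\<^sub>R (transpose (effort R \<omega>) *v \<theta>)" (is "a = ?b")
proof -
  have "agent_utility R \<theta> \<omega> ?b \<le> agent_utility R \<theta> \<omega> a"
    using assms by (simp add: is_arg_max_linorder)
  then have "(norm (a - ?b))\<^sup>2 \<le> 0"
    using agent_utility_completed_square[of R \<theta> \<omega> a] by linarith
  then show ?thesis by simp
qed

text \<open>Since \<open>measure\<close> is 0 where \<open>emeasure\<close> is infinite, positivity
  gives both conditions for normalising: nonzero and finite.\<close>

lemma prob_space_uniform_measure_of_measure_pos:
  assumes "measure M A > 0"
  shows "prob_space (uniform_measure M A)"
  using assms by (intro prob_space_uniform_measure)
    (auto simp: measure_def enn2real_positive_iff zero_less_iff_neq_zero[symmetric] less_top[symmetric])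

lemma cond_expectation_AE_const:
  assumes pos: "measure M A > 0"
    and int: "integrable (uniform_measure M A) f"
    and AE: "AE \<omega> in M. f \<omega> = c"
  shows "cond_expectation M A f = c"
proof -
  interpret U: prob_space "uniform_measure M A"
    using pos by (rule prob_space_uniform_measure_of_measure_pos)
  \<comment> \<open>\<open>measure\<close> is 0 on nonmeasurable sets.\<close>
  have "A \<in> sets M"
    using pos measure_notin_sets by force
  then have "AE \<omega> in uniform_measure M A. f \<omega> = c"
    using AE by (intro AE_uniform_measureI) auto
  then have "U.expectation f = U.expectation (\<lambda>_. c)"
    using borel_measurable_integrable[OF int] by (intro integral_cong_AE) auto
  then show ?thesis
    using U.prob_space by (simp add: cond_expectation_def)
qed

context selective_rounds
begin

text \<open>The outcome splits pointwise. Integrability of both summands carries the split over to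
  the integral, which by convention is 0 for a non-integrable function.\<close>

lemma objective_eq_cBP_plus_cPI:
  assumes "t \<in> {1..T}" "\<theta> \<in> \<Theta>"
  shows "objective M \<theta>s (R t) \<theta> = cBP M \<theta>s (R t) \<theta> + cPI M \<theta>s (R t) \<theta>"
proof -
  have "outcome \<theta>s (R t) \<theta> = (\<lambda>\<omega>. (baseline (R t) \<omega> \<bullet> \<theta>s + noise (R t) \<omega>) +
      (effort (R t) \<omega> *v action (R t) \<theta> \<omega>) \<bullet> \<theta>s)"
    by (simp add: fun_eq_iff outcome_def covariates_def covariates_of_action_def inner_add_left)
  then show ?thesis
    using baseline_outcome_integrable[OF assms] improvement_integrable[OF assms]
    by (simp add: objective_def cBP_def cPI_def cond_expectation_def)
qed

lemma cPI_const_effort: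
  assumes t: "t \<in> {1..T}" and \<theta>: "\<theta> \<in> \<Theta>"
    and effort: "AE \<omega> in M. effort (R t) \<omega> = E"
  shows "cPI M \<theta>s (R t) \<theta> = (incentive (R t) *\<^sub>R ((E ** transpose E) *v \<theta>s)) \<bullet> \<theta>"
  unfolding cPI_def
proof (rule cond_expectation_AE_const[OF selected_pos[OF t \<theta>] improvement_integrable[OF t \<theta>]])
  \<comment> \<open>\<open>E ** transpose E\<close> is symmetric, so it may act on
    \<open>\<theta>s\<close> instead of \<open>\<theta>\<close>; this exposes the coefficient vector
    of a linear form in \<open>\<theta>\<close>.\<close>
  have improvement: "(E *v (transpose E *v \<theta>)) \<bullet> \<theta>s = ((E ** transpose E) *v \<theta>s) \<bullet> \<theta>"
    by (metis dot_lmul_matrix inner_commute matrix_vector_mul_assoc transpose_matrix_vector)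
  show "AE \<omega> in M. (effort (R t) \<omega> *v action (R t) \<theta> \<omega>) \<bullet> \<theta>s =
      (incentive (R t) *\<^sub>R ((E ** transpose E) *v \<theta>s)) \<bullet> \<theta>"
    using effort AE_space
  proof eventually_elim
    case (elim \<omega>)
    then show ?case
      using best_response_unique[OF action_best_response[OF t \<theta> \<open>\<omega> \<in> space M\<close>]]
      by (simp add: matrix_vector_mult_scaleR improvement del: transpose_matrix_vector)
  qed
qed

end

lemma inner_le_norm_of_unit_ball:
  fixes c :: "'a::real_inner"
  assumes "norm x \<le> 1"
  shows "c \<bullet> x \<le> norm c"
  using norm_cauchy_schwarz[of c x] mult_left_mono[OF assms norm_ge_zero[of c]] by simp

lemma inner_sgn_self: "c \<bullet> sgn c = norm (c :: 'a::real_inner)"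
  by (cases "c = 0") (simp_all add: sgn_div_norm dot_square_norm power2_eq_square)

text \<open>This is the equality case of Cauchy-Schwarz on the unit ball: the squared distance from
  \<open>x\<close> to \<open>sgn c\<close> expands to at most 1 - 2 + 1 = 0.\<close>

lemma eq_sgn_of_inner_ge_norm:
  fixes c :: "'a::real_inner"
  assumes "c \<noteq> 0" "norm x \<le> 1" "norm c \<le> c \<bullet> x"
  shows "x = sgn c"
proof -
  have "1 \<le> x \<bullet> sgn c"
    using assms by (simp add: sgn_div_norm inner_commute field_simps)
  moreover have "(norm (x - sgn c))\<^sup>2 = (norm x)\<^sup>2 - 2 * (x \<bullet> sgn c) + (norm (sgn c))\<^sup>2"
    by (simp add: power2_norm_eq_inner inner_diff inner_commute)
  moreover have "(norm x)\<^sup>2 \<le> 1"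
    using assms(2) by (simp add: power_le_one)
  ultimately have "(norm (x - sgn c))\<^sup>2 \<le> 0"
    using assms(1) by (simp add: norm_sgn)
  then show ?thesis by simp
qed

theorem theorem3p1:
  fixes M :: "'w measure"
    and T :: nat
    and R :: "nat \<Rightarrow> ('w, 'm::finite, 'd::finite) agent_round"
    and \<delta> :: "real ^ 'm \<Rightarrow> real ^ 'm \<Rightarrow> real"
    and \<theta>s \<alpha> \<theta>AO :: "real ^ 'm"
    and \<Theta> :: "(real ^ 'm) set"
    and E :: "real ^ 'd ^ 'm"
    and \<gamma> \<beta> :: real
  assumes setting: "selective_rounds M T R \<delta> \<theta>s \<Theta>"
    and H1: "\<And>t. t \<in> {1..T} \<Longrightarrow> AE \<omega> in M. effort (R t) \<omega> = E"
    and H2_gamma: "\<gamma> \<ge> 0" "\<And>t. t \<in> {1..T} \<Longrightarrow> incentive (R t) = \<gamma>"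
    and H2_compliance: "\<And>t \<theta>. t \<in> {1..T} \<Longrightarrow> \<theta> \<in> \<Theta> \<Longrightarrow>
      cond_indep_given M (selected (R t) \<theta>)
        (count_space UNIV) (complied (R t) \<theta>)
        borel (\<lambda>\<omega>. (covariates (R t) \<theta> \<omega>, baseline (R t) \<omega>))"
    and S1: "\<And>t \<theta>. t \<in> {1..T} \<Longrightarrow> \<theta> \<in> \<Theta> \<Longrightarrow> cBP M \<theta>s (R t) \<theta> = \<alpha> \<bullet> \<theta> + \<beta>"
    and S2: "\<Theta> = {\<theta>. norm \<theta> \<le> 1}"
  defines "\<theta>AO \<equiv>
      (\<alpha> + \<gamma> *\<^sub>R ((E ** transpose E) *v \<theta>s)) /\<^sub>R norm (\<alpha> + \<gamma> *\<^sub>R ((E ** transpose E) *v \<theta>s))"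
  shows "\<forall>t\<in>{1..T}.
    is_arg_max (objective M \<theta>s (R t)) (\<lambda>\<theta>. \<theta> \<in> \<Theta>) \<theta>AO \<and>
    (\<alpha> + \<gamma> *\<^sub>R ((E ** transpose E) *v \<theta>s) \<noteq> 0 \<longrightarrow>
      (\<forall>\<theta>. is_arg_max (objective M \<theta>s (R t)) (\<lambda>\<theta>. \<theta> \<in> \<Theta>) \<theta> \<longrightarrow> \<theta> = \<theta>AO))"
proof (intro ballI)
  fix t assume t: "t \<in> {1..T}"
  interpret selective_rounds M T R \<delta> \<theta>s \<Theta> by (fact setting)
  define c where "c = \<alpha> + \<gamma> *\<^sub>R ((E ** transpose E) *v \<theta>s)"
  \<comment> \<open>As \<open>sgn 0 = 0\<close> agrees with division by zero, this also covers
    \<open>c = 0\<close>, where the parameter 0 still lies in the unit ball.\<close>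
  have AO: "\<theta>AO = sgn c"
    by (simp add: \<theta>AO_def c_def sgn_div_norm)
  have AO_in: "\<theta>AO \<in> \<Theta>"
    by (simp add: AO S2 norm_sgn)
  have obj: "objective M \<theta>s (R t) \<theta> = c \<bullet> \<theta> + \<beta>" if "\<theta> \<in> \<Theta>" for \<theta>
    using objective_eq_cBP_plus_cPI[OF t that] cPI_const_effort[OF t that H1[OF t]]
      S1[OF t that] H2_gamma(2)[OF t]
    by (simp add: c_def inner_add_left)
  have obj_AO: "objective M \<theta>s (R t) \<theta>AO = norm c + \<beta>"
    using obj[OF AO_in] by (simp add: AO inner_sgn_self)
  have "is_arg_max (objective M \<theta>s (R t)) (\<lambda>\<theta>. \<theta> \<in> \<Theta>) \<theta>AO"
    using AO_in obj obj_AO S2 by (auto simp: is_arg_max_linorder inner_le_norm_of_unit_ball)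
  moreover have "\<theta> = \<theta>AO"
    if "c \<noteq> 0" and max: "is_arg_max (objective M \<theta>s (R t)) (\<lambda>\<theta>. \<theta> \<in> \<Theta>) \<theta>" for \<theta>
  proof -
    \<comment> \<open>A maximiser does at least as well as \<open>\<theta>AO\<close>, whose value is
      \<open>norm c + \<beta>\<close>; hence
      \<open>norm c \<le> c \<bullet> \<theta>\<close>.\<close>
    have "\<theta> \<in> \<Theta>" and "objective M \<theta>s (R t) \<theta>AO \<le> objective M \<theta>s (R t) \<theta>"
      using max AO_in by (auto simp: is_arg_max_linorder)
    then show ?thesis
      using eq_sgn_of_inner_ge_norm[OF \<open>c \<noteq> 0\<close>, of \<theta>] obj obj_AO S2 by (simp add: AO)
  qed
  ultimately show "is_arg_max (objective M \<theta>s (R t)) (\<lambda>\<theta>. \<theta> \<in> \<Theta>) \<theta>AO \<and>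
    (\<alpha> + \<gamma> *\<^sub>R ((E ** transpose E) *v \<theta>s) \<noteq> 0 \<longrightarrow>
      (\<forall>\<theta>. is_arg_max (objective M \<theta>s (R t)) (\<lambda>\<theta>. \<theta> \<in> \<Theta>) \<theta> \<longrightarrow> \<theta> = \<theta>AO))"
    unfolding c_def by blast
qed

end
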